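(* Let $(V,\rho)$ be a finite-dimensional representation of $\mathcal{B}$, let $X_2=\rho(x_2)$ and $T=\rho(x_2^2)$, and let $\lambda_1,\ldots,\lambda_t$ be the different eigenvalues of $T$. Then each generalized eigenspace $V_{\lambda_i}^T=\bigcup_{j\ge 0}\ker(T-\lambda_i\,\mathrm{id})^j$ is a $\mathcal{B}$-submodule of $V$ and $V=\bigoplus_{i=1}^t V_{\lambda_i}^T$. In particular, if $V$ is indecomposable then $T$ has a unique eigenvalue; hence either $X_2$ has a unique eigenvalue, or else the eigenvalues of $X_2$ are $\lambda$ and $-\lambda$ for some $\lambda\in\Bbbk^{\times}$.
   Context: $\Bbbk$ is an algebraically closed field of characteristic $0$. The super Jordan plane $\mathcal{B}$ is the associative unital $\Bbbk$-algebra generated by $x_1,x_2$ with defining relations $x_1^2=0$ and $x_2x_{21}=x_{21}x_2+x_1x_{21}$, where $x_{21}:=x_1x_2+x_2x_1$. *)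

theory Defs
  imports
    "HOL-Library.FuncSet"
    "HOL-Library.Poly_Mapping"
    "HOL-Computational_Algebra.Polynomial"
begin

section \<open>The free algebra on two generators\<close>

datatype letter = L1 | L2

text \<open>A copy of lists, so that concatenation can serve as the addition of a \<open>monoid_add\<close>,
  which is what the convolution product of \<open>poly_mapping\<close> requires of its exponents.\<close>

datatype word = Word (letters: "letter list")

instantiation word :: monoid_add
begin

definition zero_word :: word where "zero_word = Word []"

definition plus_word :: "word \<Rightarrow> word \<Rightarrow> word" where
  "plus_word v w = Word (letters v @ letters w)"

instance
  by standard (simp_all add: zero_word_def plus_word_def)

end

lemma word_plus_eq_0_iff: "(v :: word) + w = 0 \<longleftrightarrow> v = 0 \<and> w = 0"
  by (cases v; cases w) (simp add: zero_word_def plus_word_def)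

type_synonym 'k free_alg = "word \<Rightarrow>\<^sub>0 'k"

definition fscalar :: "'k::field \<Rightarrow> 'k free_alg" where
  "fscalar c = Poly_Mapping.single 0 c"

definition fx1 :: "'k::field free_alg" where
  "fx1 = Poly_Mapping.single (Word [L1]) 1"

definition fx2 :: "'k::field free_alg" where
  "fx2 = Poly_Mapping.single (Word [L2]) 1"

definition fx21 :: "'k::field free_alg" where
  "fx21 = fx1 * fx2 + fx2 * fx1"


section \<open>The super Jordan plane\<close>

text \<open>Each relation \<open>l = r\<close> is represented by the element \<open>l - r\<close>.\<close>

definition sjp_relators :: "'k::field free_alg set" where
  "sjp_relators = {fx1 ^ 2, fx2 * fx21 - (fx21 * fx2 + fx1 * fx21)}"

inductive_set two_sided_ideal :: "'r::ring_1 set \<Rightarrow> 'r set" for S where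
  zero: "0 \<in> two_sided_ideal S"
| base: "s \<in> S \<Longrightarrow> s \<in> two_sided_ideal S"
| add: "a \<in> two_sided_ideal S \<Longrightarrow> b \<in> two_sided_ideal S \<Longrightarrow> a + b \<in> two_sided_ideal S"
| left: "a \<in> two_sided_ideal S \<Longrightarrow> r * a \<in> two_sided_ideal S"
| right: "a \<in> two_sided_ideal S \<Longrightarrow> a * r \<in> two_sided_ideal S"

lemma two_sided_ideal_uminus: "a \<in> two_sided_ideal S \<Longrightarrow> - a \<in> two_sided_ideal S"
  using two_sided_ideal.left[of a S "-1"] by simp

lemma two_sided_ideal_diff:
  "a \<in> two_sided_ideal S \<Longrightarrow> b \<in> two_sided_ideal S \<Longrightarrow> a - b \<in> two_sided_ideal S"
  using two_sided_ideal.add[of a S "- b"] two_sided_ideal_uminus[of b S] by simp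

definition sjp_rel :: "'k::field free_alg \<Rightarrow> 'k free_alg \<Rightarrow> bool" where
  "sjp_rel a b \<longleftrightarrow> a - b \<in> two_sided_ideal sjp_relators"

lemma equivp_sjp_rel: "equivp (sjp_rel :: 'k::field free_alg \<Rightarrow> _)"
proof (rule equivpI)
  show "reflp (sjp_rel :: 'k free_alg \<Rightarrow> _)"
    by (rule reflpI) (simp add: sjp_rel_def two_sided_ideal.zero)
  show "symp (sjp_rel :: 'k free_alg \<Rightarrow> _)"
    by (rule sympI) (metis sjp_rel_def two_sided_ideal_uminus minus_diff_eq)
  show "transp (sjp_rel :: 'k free_alg \<Rightarrow> _)"
  proof (rule transpI)
    fix a b c :: "'k free_alg"
    assume "sjp_rel a b" "sjp_rel b c"
    then have "(a - b) + (b - c) \<in> two_sided_ideal sjp_relators"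
      unfolding sjp_rel_def by (rule two_sided_ideal.add)
    then show "sjp_rel a c" by (simp add: sjp_rel_def)
  qed
qed

quotient_type (overloaded) 'k sjp = "'k::field free_alg" / sjp_rel
  by (rule equivp_sjp_rel)

lemma lookup_mult_empty_word:
  fixes a b :: "'k::field free_alg"
  shows "Poly_Mapping.lookup (a * b) 0 = Poly_Mapping.lookup a 0 * Poly_Mapping.lookup b 0"
proof -
  have eq: "Poly_Mapping.lookup a l * (\<Sum>q. Poly_Mapping.lookup b q when 0 = l + q)
      = (Poly_Mapping.lookup a 0 * Poly_Mapping.lookup b 0 when l = 0)" for l :: word
  proof (cases "l = 0")
    case True
    then show ?thesis by simp
  next
    case False
    then have "(0 = l + q) = False" for q
      using word_plus_eq_0_iff[of l q] by auto
    then show ?thesis using False by simp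
  qed
  show ?thesis unfolding lookup_mult eq by simp
qed

lemma sjp_ideal_lookup_empty_word:
  assumes "a \<in> two_sided_ideal (sjp_relators :: 'k::field free_alg set)"
  shows "Poly_Mapping.lookup a 0 = 0"
  using assms
proof induction
  case (base s)
  have "Poly_Mapping.lookup (fx1 :: 'k free_alg) 0 = 0"
    by (simp add: fx1_def lookup_single zero_word_def)
  moreover have "Poly_Mapping.lookup (fx2 :: 'k free_alg) 0 = 0"
    by (simp add: fx2_def lookup_single zero_word_def)
  ultimately show ?case
    using base
    by (auto simp: sjp_relators_def power2_eq_square lookup_minus lookup_add
        lookup_mult_empty_word)
qed (simp_all add: lookup_add lookup_mult_empty_word)

instantiation sjp :: (field) ring_1
begin

lift_definition zero_sjp :: "'a sjp" is 0 .

lift_definition one_sjp :: "'a sjp" is 1 .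

lift_definition plus_sjp :: "'a sjp \<Rightarrow> 'a sjp \<Rightarrow> 'a sjp" is "(+)"
  unfolding sjp_rel_def by (metis two_sided_ideal.add add_diff_add)

lift_definition uminus_sjp :: "'a sjp \<Rightarrow> 'a sjp" is uminus
  unfolding sjp_rel_def by (metis two_sided_ideal_uminus minus_diff_minus)

lift_definition minus_sjp :: "'a sjp \<Rightarrow> 'a sjp \<Rightarrow> 'a sjp" is "(-)"
proof -
  fix a b c d :: "'a free_alg"
  assume "sjp_rel a b" "sjp_rel c d"
  then have "(a - b) - (c - d) \<in> two_sided_ideal sjp_relators"
    unfolding sjp_rel_def by (rule two_sided_ideal_diff)
  moreover have "(a - b) - (c - d) = (a - c) - (b - d)" by simp
  ultimately show "sjp_rel (a - c) (b - d)" by (simp only: sjp_rel_def)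
qed

lift_definition times_sjp :: "'a sjp \<Rightarrow> 'a sjp \<Rightarrow> 'a sjp" is "(*)"
proof -
  fix a b c d :: "'a free_alg"
  assume "sjp_rel a b" "sjp_rel c d"
  then have "(a - b) * c + b * (c - d) \<in> two_sided_ideal sjp_relators"
    unfolding sjp_rel_def
    by (intro two_sided_ideal.add two_sided_ideal.left two_sided_ideal.right)
  moreover have "(a - b) * c + b * (c - d) = a * c - b * d" by (simp add: algebra_simps)
  ultimately show "sjp_rel (a * c) (b * d)" by (simp only: sjp_rel_def)
qed

instance
proof
  fix a b c :: "'a sjp"
  note R = equivp_reflp[OF equivp_sjp_rel]
  show "a + b + c = a + (b + c)" by transfer (simp add: R add.assoc)
  show "a + b = b + a" by transfer (simp add: R add.commute)
  show "0 + a = a" by transfer (simp add: R)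
  show "- a + a = 0" by transfer (simp add: R)
  show "a - b = a + - b" by transfer (simp add: R)
  show "a * b * c = a * (b * c)" by transfer (simp add: R mult.assoc)
  show "1 * a = a" by transfer (simp add: R)
  show "a * 1 = a" by transfer (simp add: R)
  show "(a + b) * c = a * c + b * c" by transfer (simp add: R distrib_right)
  show "a * (b + c) = a * b + a * c" by transfer (simp add: R distrib_left)
  show "0 \<noteq> (1 :: 'a sjp)"
  proof transfer
    show "\<not> sjp_rel 0 (1 :: 'a free_alg)"
      using sjp_ideal_lookup_empty_word[of "0 - 1 :: 'a free_alg"]
      by (auto simp: sjp_rel_def)
  qed
qed

end

lift_definition sjp_scale :: "'k::field \<Rightarrow> 'k sjp \<Rightarrow> 'k sjp" is "\<lambda>c a. fscalar c * a"
  unfolding sjp_rel_def right_diff_distrib[symmetric] by (rule two_sided_ideal.left)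

lift_definition sjp_x1 :: "'k::field sjp" is fx1 .

lift_definition sjp_x2 :: "'k::field sjp" is fx2 .

lemma sjp_x1_squared: "sjp_x1 ^ 2 = (0 :: 'k::field sjp)"
  unfolding power2_eq_square
  by transfer (auto simp: sjp_rel_def sjp_relators_def power2_eq_square
      intro!: two_sided_ideal.base)

lemma sjp_x2_x21:
  "sjp_x2 * (sjp_x1 * sjp_x2 + sjp_x2 * sjp_x1) =
    (sjp_x1 * sjp_x2 + sjp_x2 * sjp_x1) * sjp_x2 +
    sjp_x1 * (sjp_x1 * sjp_x2 + sjp_x2 * sjp_x1 :: 'k::field sjp)"
  by transfer (auto simp: sjp_rel_def sjp_relators_def fx21_def
      intro!: two_sided_ideal.base)


section \<open>Representations\<close>

text \<open>The axioms say that \<open>\<rho>\<close> is a unital algebra homomorphism from \<open>'k sjp\<close> to the algebra of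
  linear endomorphisms of the finite-dimensional space \<open>'v\<close>.\<close>

locale sjp_fd_representation = vector_space scale
  for scale :: "'k::field \<Rightarrow> 'v::ab_group_add \<Rightarrow> 'v" +
  fixes \<rho> :: "'k sjp \<Rightarrow> 'v \<Rightarrow> 'v"
  assumes finite_dim: "\<exists>B. finite B \<and> span B = UNIV"
    and linear_rep: "Vector_Spaces.linear scale scale (\<rho> a)"
    and rep_add: "\<rho> (a + b) v = \<rho> a v + \<rho> b v"
    and rep_scale: "\<rho> (sjp_scale c a) v = scale c (\<rho> a v)"
    and rep_one: "\<rho> 1 = id"
    and rep_mult: "\<rho> (a * b) = \<rho> a \<circ> \<rho> b"

definition is_submodule ::
  "('k::field \<Rightarrow> 'v::ab_group_add \<Rightarrow> 'v) \<Rightarrow> ('k sjp \<Rightarrow> 'v \<Rightarrow> 'v) \<Rightarrow> 'v set \<Rightarrow> bool" where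
  "is_submodule scale \<rho> U \<longleftrightarrow>
    module.subspace scale U \<and> (\<forall>a. \<forall>u\<in>U. \<rho> a u \<in> U)"

definition indecomposable ::
  "('k::field \<Rightarrow> 'v::ab_group_add \<Rightarrow> 'v) \<Rightarrow> ('k sjp \<Rightarrow> 'v \<Rightarrow> 'v) \<Rightarrow> bool" where
  "indecomposable scale \<rho> \<longleftrightarrow>
    (UNIV :: 'v set) \<noteq> {0} \<and>
    (\<forall>U W. is_submodule scale \<rho> U \<longrightarrow> is_submodule scale \<rho> W \<longrightarrow>
      U \<inter> W = {0} \<longrightarrow> {u + w |u w. u \<in> U \<and> w \<in> W} = UNIV \<longrightarrow> U = {0} \<or> W = {0})"

text \<open>The whole space is the internal direct sum of the family \<open>U\<close> over the finite set \<open>I\<close>;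
  \<open>PiE\<close> pins the families down outside \<open>I\<close>, as uniqueness requires.\<close>

definition is_direct_sum :: "'i set \<Rightarrow> ('i \<Rightarrow> 'v::ab_group_add set) \<Rightarrow> bool" where
  "is_direct_sum I U \<longleftrightarrow> finite I \<and> (\<forall>v. \<exists>!u. u \<in> PiE I U \<and> v = (\<Sum>i\<in>I. u i))"

definition is_eigenvalue ::
  "('k::field \<Rightarrow> 'v::ab_group_add \<Rightarrow> 'v) \<Rightarrow> ('v \<Rightarrow> 'v) \<Rightarrow> 'k \<Rightarrow> bool" where
  "is_eigenvalue scale T \<mu> \<longleftrightarrow> (\<exists>v. v \<noteq> 0 \<and> T v = scale \<mu> v)"

definition gen_eigenspace ::
  "('k::field \<Rightarrow> 'v::ab_group_add \<Rightarrow> 'v) \<Rightarrow> ('v \<Rightarrow> 'v) \<Rightarrow> 'k \<Rightarrow> 'v set" where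
  "gen_eigenspace scale T \<mu> = (\<Union>j. {v. ((\<lambda>w. T w - scale \<mu> w) ^^ j) v = 0})"

end

theory Submission
  imports Defs
begin

text \<open>Put \<open>z = x\<^sub>1 x\<^sub>2 + x\<^sub>2 x\<^sub>1\<close> and \<open>t = x\<^sub>2\<^sup>2\<close>. The defining relations give \<open>[t, x\<^sub>1] = x\<^sub>1 z\<close> and
  \<open>[t, z] = z\<^sup>2\<close>. In characteristic \<open>0\<close> the second identity makes \<open>z\<close> nilpotent on \<open>V\<close>: if
  \<open>z v = \<mu> v\<close> with \<open>\<mu> \<noteq> 0\<close>, then \<open>(z - \<mu>)\<^sup>k t\<^sup>k v = k! (- \<mu>\<^sup>2)\<^sup>k v\<close>, so all \<open>t\<^sup>k v\<close> would be linearly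
  independent. Hence \<open>ad t\<close> acts nilpotently on \<open>x\<^sub>1\<close>, and \<open>x\<^sub>1\<close> preserves the generalized eigenspaces
  of \<open>t\<close>, while \<open>x\<^sub>2\<close> preserves them because it commutes with \<open>t\<close>.\<close>

section \<open>Linear dependence of sequences in finite dimension\<close>

text \<open>The vectors \<open>w 0, ..., w (card B)\<close> are one too many to be distinct and
  independent. A polynomial carries the relation, so that its last coefficient is nonzero and, for
  \<open>w i = (f ^^ i) v\<close>, the relation reads \<open>p(f) v = 0\<close>.\<close>

lemma (in vector_space) sequence_dependent:
  assumes B: "finite B" "span B = UNIV"
  obtains p :: "'a poly" where "p \<noteq> 0" "(\<Sum>i\<le>degree p. coeff p i *s w i) = 0"
proof (cases "inj_on w {..card B}")
  case True
  have "card (w ` {..card B}) = Suc (card B)"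
    using True by (simp add: card_image)
  then have "dependent (w ` {..card B})"
    using independent_span_bound[of B "w ` {..card B}"] B by auto
  then obtain u j where u: "j \<le> card B" "u (w j) \<noteq> 0" "(\<Sum>v\<in>w ` {..card B}. u v *s v) = 0"
    by (subst (asm) dependent_finite) auto
  then have sum0: "(\<Sum>i\<le>card B. u (w i) *s w i) = 0"
    using True by (simp add: sum.reindex)
  define p where "p = (\<Sum>i\<le>card B. monom (u (w i)) i)"
  have c: "coeff p i = (if i \<le> card B then u (w i) else 0)" for i
    by (simp add: p_def coeff_sum sum.delta)
  have d: "degree p \<le> card B"
    by (rule degree_le) (simp add: c)
  show thesis
  proof
    show "p \<noteq> 0" using u(1,2) c[of j] by auto
    have "(\<Sum>i\<le>degree p. coeff p i *s w i) = (\<Sum>i\<le>card B. coeff p i *s w i)"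
      by (rule sum.mono_neutral_left) (use d in \<open>auto simp: coeff_eq_0\<close>)
    also have "\<dots> = 0"
      using sum0 by (simp add: c)
    finally show "(\<Sum>i\<le>degree p. coeff p i *s w i) = 0" .
  qed
next
  case False
  then obtain i j where ij: "i < j" "w i = w j"
    by (metis inj_onI linorder_neqE_nat)
  \<comment> \<open>A repetition is itself a relation, \<open>w j - w i = 0\<close>.\<close>
  define p where "p = monom 1 j - monom (1::'a) i"
  have c: "coeff p k = (if k = j then 1 else if k = i then - 1 else 0)" for k
    using ij by (simp add: p_def)
  have d: "degree p \<le> j"
    by (rule degree_le) (use ij in \<open>simp add: c\<close>)
  show thesis
  proof
    show "p \<noteq> 0" using c[of j] by auto
    have "(\<Sum>k\<le>degree p. coeff p k *s w k) = (\<Sum>k\<in>{i,j}. coeff p k *s w k)"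
      by (rule sum.mono_neutral_cong)
        (use d ij in \<open>auto simp: c le_degree split: if_splits\<close>)
    also have "\<dots> = 0"
      using ij by (simp add: c)
    finally show "(\<Sum>k\<le>degree p. coeff p k *s w k) = 0" .
  qed
qed

section \<open>Generalized eigenspaces of one endomorphism\<close>

locale endomorphism = vector_space scale
  for scale :: "'k::field \<Rightarrow> 'v::ab_group_add \<Rightarrow> 'v" (infixr \<open>*s\<close> 75) +
  fixes f :: "'v \<Rightarrow> 'v"
  assumes linear: "Vector_Spaces.linear scale scale f"
begin

lemmas map_add = module_hom.add[OF linear[folded module_hom_iff_linear]]
lemmas map_scale = module_hom.scale[OF linear[folded module_hom_iff_linear]]
lemmas map_zero = module_hom.zero[OF linear[folded module_hom_iff_linear]]
lemmas map_sum = module_hom.sum[OF linear[folded module_hom_iff_linear]]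
lemmas map_diff = module_hom.diff[OF linear[folded module_hom_iff_linear]]

text \<open>As a named map, \<open>f - \<mu>\<close> and its powers can instantiate the locale
  again, which supplies their linearity; \<open>f\<close> itself is the case \<mu> = 0.\<close>

definition shifted :: "'k \<Rightarrow> 'v \<Rightarrow> 'v" where
  "shifted \<mu> w = f w - \<mu> *s w"

abbreviation E :: "'k \<Rightarrow> 'v set" where
  "E \<equiv> gen_eigenspace scale f"

lemma funpow_linear: "Vector_Spaces.linear scale scale (f ^^ n)"
  by (induction n)
    (use linear in \<open>auto simp: Vector_Spaces.linear_iff vector_space_axioms\<close>)

lemma endomorphism_funpow: "endomorphism scale (f ^^ n)"
  by (simp add: endomorphism_def endomorphism_axioms_def vector_space_axioms funpow_linear)

lemma endomorphism_shifted: "endomorphism scale (shifted \<mu>)"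
  by (unfold_locales)
    (auto simp: shifted_def Vector_Spaces.linear_iff vector_space_axioms map_add map_scale
      scale_right_distrib scale_right_diff_distrib mult.commute)

lemma endomorphism_shifted_funpow: "endomorphism scale (shifted \<mu> ^^ n)"
  using endomorphism.endomorphism_funpow[OF endomorphism_shifted] .

lemmas shifted_add = endomorphism.map_add[OF endomorphism_shifted]
lemmas shifted_scale = endomorphism.map_scale[OF endomorphism_shifted]
lemmas shifted_zero = endomorphism.map_zero[OF endomorphism_shifted]
lemmas shifted_diff = endomorphism.map_diff[OF endomorphism_shifted]
lemmas shifted_funpow_add = endomorphism.map_add[OF endomorphism_shifted_funpow]
lemmas shifted_funpow_scale = endomorphism.map_scale[OF endomorphism_shifted_funpow]
lemmas shifted_funpow_zero = endomorphism.map_zero[OF endomorphism_shifted_funpow]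

lemma shifted_0: "shifted 0 = f"
  by (rule ext) (simp add: shifted_def)

lemma shifted_commute: "shifted \<mu> (shifted \<nu> w) = shifted \<nu> (shifted \<mu> w)"
  by (simp add: shifted_def map_diff map_scale scale_right_diff_distrib mult.commute)

lemma shifted_funpow_commute: "(shifted \<mu> ^^ n) (shifted \<nu> w) = shifted \<nu> ((shifted \<mu> ^^ n) w)"
  by (induction n) (simp_all add: shifted_commute[of \<mu> \<nu>])

lemma shifted_funpow_map: "(shifted \<mu> ^^ n) (f w) = f ((shifted \<mu> ^^ n) w)"
  using shifted_funpow_commute[where \<nu> = 0] by (simp add: shifted_0)

lemma shifted_map: "shifted \<mu> (f w) = f (shifted \<mu> w)"
  using shifted_commute[of \<mu> 0] by (simp add: shifted_0)

lemma mem_E_iff: "v \<in> E \<mu> \<longleftrightarrow> (\<exists>n. (shifted \<mu> ^^ n) v = 0)"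
  by (simp add: gen_eigenspace_def shifted_def[abs_def])

lemma shifted_funpow_eq_0_mono:
  assumes "(shifted \<mu> ^^ n) v = 0" "n \<le> m"
  shows "(shifted \<mu> ^^ m) v = 0"
  using assms(2,1) by (induction rule: dec_induct) (simp_all add: shifted_zero)

lemma subspace_E: "subspace (E \<mu>)"
proof (rule subspaceI)
  show "0 \<in> E \<mu>"
    unfolding mem_E_iff by (intro exI[of _ 0]) simp
next
  fix x y assume "x \<in> E \<mu>" "y \<in> E \<mu>"
  then obtain n m where "(shifted \<mu> ^^ n) x = 0" "(shifted \<mu> ^^ m) y = 0"
    by (auto simp: mem_E_iff)
  then have "(shifted \<mu> ^^ max n m) (x + y) = 0"
    using shifted_funpow_eq_0_mono[where n = n and v = x and m = "max n m"]
      shifted_funpow_eq_0_mono[where n = m and v = y and m = "max n m"]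
    by (simp add: shifted_funpow_add)
  then show "x + y \<in> E \<mu>"
    unfolding mem_E_iff by blast
next
  fix c x assume "x \<in> E \<mu>"
  then show "c *s x \<in> E \<mu>"
    unfolding mem_E_iff by (metis shifted_funpow_scale scale_zero_right)
qed

text \<open>A map commuting with \<open>f\<close> commutes with the powers of
  \<open>f - \<mu>\<close>, hence preserves their kernels.\<close>

lemma E_commuting:
  assumes "endomorphism scale g" "\<And>w. f (g w) = g (f w)" "v \<in> E \<mu>"
  shows "g v \<in> E \<mu>"
proof -
  interpret g: endomorphism scale g by fact
  have "(shifted \<mu> ^^ n) (g v) = g ((shifted \<mu> ^^ n) v)" for n
    by (induction n) (simp_all add: shifted_def assms(2) g.map_diff g.map_scale)
  then show ?thesis
    using assms(3) unfolding mem_E_iff by (metis g.map_zero)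
qed

lemma E_shifted: "v \<in> E \<mu> \<Longrightarrow> shifted \<nu> v \<in> E \<mu>"
  by (rule E_commuting[OF endomorphism_shifted]) (simp_all add: shifted_map)

lemma E_shifted_funpow: "v \<in> E \<mu> \<Longrightarrow> (shifted \<nu> ^^ n) v \<in> E \<mu>"
  by (induction n) (auto intro: E_shifted)

lemma E_if_shifted:
  assumes "shifted \<mu> v \<in> E \<mu>"
  shows "v \<in> E \<mu>"
proof -
  from assms obtain n where "(shifted \<mu> ^^ n) (shifted \<mu> v) = 0"
    by (auto simp: mem_E_iff)
  then have "(shifted \<mu> ^^ Suc n) v = 0"
    by (simp only: funpow_Suc_right comp_apply)
  then show ?thesis
    unfolding mem_E_iff by blast
qed

lemma eigenvector_in_E: "f v = \<mu> *s v \<Longrightarrow> v \<in> E \<mu>"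
  unfolding mem_E_iff by (intro exI[of _ 1]) (simp add: shifted_def)

text \<open>The last nonzero vector in the chain \<open>v\<close>, \<open>(f - \<mu>) v\<close>, ...
  is an eigenvector.\<close>

lemma eigenvalue_if_E_nontrivial:
  assumes "v \<in> E \<mu>" "v \<noteq> 0"
  shows "is_eigenvalue scale f \<mu>"
proof -
  from assms(1) obtain n where "(shifted \<mu> ^^ n) v = 0"
    by (auto simp: mem_E_iff)
  then show ?thesis using assms(2)
  proof (induction n arbitrary: v)
    case (Suc n)
    show ?case
    proof (cases "shifted \<mu> v = 0")
      case True
      then show ?thesis using Suc.prems(2) by (auto simp: is_eigenvalue_def shifted_def)
    next
      case False
      then show ?thesis using Suc.IH[of "shifted \<mu> v"] Suc.prems(1)
        by (simp del: funpow.simps add: funpow_Suc_right)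
    qed
  qed simp
qed

text \<open>On the kernel of \<open>f - \<nu>\<close> the map \<open>f - \<mu>\<close> is
  multiplication by the nonzero scalar \<open>\<nu> - \<mu>\<close>, so no power of it kills a
  nonzero vector there.\<close>

lemma shifted_inj_on_E:
  assumes "v \<in> E \<mu>" "shifted \<nu> v = 0" "\<mu> \<noteq> \<nu>"
  shows "v = 0"
proof -
  from assms(1) obtain n where "(shifted \<mu> ^^ n) v = 0"
    by (auto simp: mem_E_iff)
  then show ?thesis
  proof (induction n)
    case (Suc n)
    have "shifted \<mu> v = (\<nu> - \<mu>) *s v"
      using assms(2) by (simp add: shifted_def scale_left_diff_distrib)
    then have "(\<nu> - \<mu>) *s (shifted \<mu> ^^ n) v = 0"
      using Suc.prems by (simp del: funpow.simps add: funpow_Suc_right shifted_funpow_scale)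
    then show ?case
      using assms(3) Suc.IH by simp
  qed simp
qed

lemma shifted_funpow_inj_on_E:
  assumes "v \<in> E \<mu>" "(shifted \<nu> ^^ n) v = 0" "\<mu> \<noteq> \<nu>"
  shows "v = 0"
  using assms(2)
proof (induction n)
  case (Suc n)
  then have "shifted \<nu> ((shifted \<nu> ^^ n) v) = 0" by simp
  then show ?case
    using Suc.IH shifted_inj_on_E[OF E_shifted_funpow[OF assms(1)]] assms(3) by blast
qed simp

text \<open>On \<open>E \<nu>\<close> the map \<open>f - \<mu>\<close> is the nonzero scalar
  \<open>\<nu> - \<mu>\<close> plus the locally nilpotent \<open>f - \<nu>\<close>. The induction
  unrolls the geometric series for its inverse.\<close>

lemma shifted_surj_on_E:
  assumes "w \<in> E \<nu>" "\<mu> \<noteq> \<nu>"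
  shows "\<exists>v\<in>E \<nu>. shifted \<mu> v = w"
proof -
  from assms(1) obtain n where "(shifted \<nu> ^^ n) w = 0"
    by (auto simp: mem_E_iff)
  then show ?thesis
  proof (induction n arbitrary: w)
    case 0
    then show ?case using subspace_0[OF subspace_E] by (auto simp: shifted_zero intro!: bexI[of _ 0])
  next
    case (Suc n)
    then have "(shifted \<nu> ^^ n) (shifted \<nu> w) = 0"
      by (simp only: funpow_Suc_right comp_apply)
    from Suc.IH[OF this] obtain v where v: "v \<in> E \<nu>" "shifted \<mu> v = shifted \<nu> w"
      by blast
    have w: "w \<in> E \<nu>" using Suc.prems mem_E_iff by blast
    \<comment> \<open>Since \<open>(f - \<mu>) v = (f - \<nu>) w\<close>, subtracting
      \<open>v\<close> leaves only the scalar part.\<close>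
    have "shifted \<mu> (w - v) = (\<nu> - \<mu>) *s w"
      unfolding shifted_diff v by (simp add: shifted_def scale_left_diff_distrib)
    then have "shifted \<mu> ((1 / (\<nu> - \<mu>)) *s (w - v)) = w"
      unfolding shifted_scale using assms(2) by simp
    moreover have "(1 / (\<nu> - \<mu>)) *s (w - v) \<in> E \<nu>"
      using v w subspace_E by (simp add: subspace_scale subspace_diff)
    ultimately show ?case by blast
  qed
qed

text \<open>A power of \<open>f - \<kappa>\<close> that kills the \<kappa>-component preserves the
  other spaces and is injective on them, so the induction hypothesis for the images returns the
  vanishing of the other components.\<close>

lemma E_independent:
  assumes "finite F" "\<And>\<nu>. \<nu> \<in> F \<Longrightarrow> u \<nu> \<in> E \<nu>" "(\<Sum>\<nu>\<in>F. u \<nu>) = 0" "\<nu> \<in> F"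
  shows "u \<nu> = 0"
  using assms
proof (induction F arbitrary: u \<nu> rule: finite_induct)
  case (insert \<kappa> F)
  from insert.prems(1) obtain n where n: "(shifted \<kappa> ^^ n) (u \<kappa>) = 0"
    by (auto simp: mem_E_iff)
  interpret P: endomorphism scale "shifted \<kappa> ^^ n"
    by (rule endomorphism_shifted_funpow)
  have "(\<Sum>\<nu>\<in>F. (shifted \<kappa> ^^ n) (u \<nu>)) = (shifted \<kappa> ^^ n) (u \<kappa> + (\<Sum>\<nu>\<in>F. u \<nu>))"
    using n by (simp only: P.map_add P.map_sum) simp
  also have "\<dots> = 0"
    using insert by (simp add: P.map_zero)
  finally have "(shifted \<kappa> ^^ n) (u \<nu>) = 0" if "\<nu> \<in> F" for \<nu>
    using insert.IH[of "\<lambda>\<nu>. (shifted \<kappa> ^^ n) (u \<nu>)" \<nu>] insert.prems that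
    by (auto intro: E_shifted_funpow)
  then have F: "u \<nu> = 0" if "\<nu> \<in> F" for \<nu>
    using shifted_funpow_inj_on_E[where v = "u \<nu>" and \<mu> = \<nu> and \<nu> = \<kappa> and n = n] insert.prems(1) insert.hyps(2) that by auto
  then show ?case
    using insert by auto
qed simp

lemma sum_of_E_if_span:
  assumes "finite F" "v \<in> span (\<Union>\<nu>\<in>F. E \<nu>)"
  obtains u where "\<And>\<nu>. u \<nu> \<in> E \<nu>" "v = (\<Sum>\<nu>\<in>F. u \<nu>)"
proof -
  have "\<exists>u. (\<forall>\<nu>. u \<nu> \<in> E \<nu>) \<and> v = (\<Sum>\<nu>\<in>F. u \<nu>)"
    using assms(2)
  proof (induction rule: span_induct_alt)
    case base
    then show ?case using subspace_0[OF subspace_E] by (intro exI[of _ "\<lambda>_. 0"]) auto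
  next
    case (step c x y)
    then obtain u \<mu> where u: "\<forall>\<nu>. u \<nu> \<in> E \<nu>" "y = (\<Sum>\<nu>\<in>F. u \<nu>)" "\<mu> \<in> F" "x \<in> E \<mu>"
      by blast
    show ?case
    proof (intro exI[of _ "u(\<mu> := c *s x + u \<mu>)"] conjI)
      show "\<forall>\<nu>. (u(\<mu> := c *s x + u \<mu>)) \<nu> \<in> E \<nu>"
        using u subspace_E by (simp add: subspace_add subspace_scale)
      have "(\<Sum>\<nu>\<in>F. (u(\<mu> := c *s x + u \<mu>)) \<nu>) = (c *s x + u \<mu>) + (\<Sum>\<nu>\<in>F - {\<mu>}. u \<nu>)"
        using u assms(1) by (subst sum.remove[of F \<mu>]) (auto intro!: sum.cong)
      also have "\<dots> = c *s x + y"
        using u assms(1) by (simp add: sum.remove[of F \<mu>] add.assoc)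
      finally show "c *s x + y = (\<Sum>\<nu>\<in>F. (u(\<mu> := c *s x + u \<mu>)) \<nu>)" by simp
    qed
  qed
  then show thesis using that by blast
qed

lemma E_Int_span:
  assumes "finite F" "\<mu> \<notin> F" "v \<in> E \<mu>" "v \<in> span (\<Union>\<nu>\<in>F. E \<nu>)"
  shows "v = 0"
proof -
  obtain u where u: "\<And>\<nu>. u \<nu> \<in> E \<nu>" "v = (\<Sum>\<nu>\<in>F. u \<nu>)"
    using sum_of_E_if_span[OF assms(1,4)] by blast
  \<comment> \<open>Placing \<open>- v\<close> at the index \<mu> outside \<open>F\<close> turns the
    expansion of \<open>v\<close> into a vanishing sum.\<close>
  define w where "w = u(\<mu> := - v)"
  have "w \<nu> \<in> E \<nu>" for \<nu>
    using u(1) assms(3) subspace_neg[OF subspace_E] by (simp add: w_def)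
  moreover have "(\<Sum>\<nu>\<in>F. w \<nu>) = (\<Sum>\<nu>\<in>F. u \<nu>)"
    using assms(2) by (intro sum.cong) (auto simp: w_def)
  then have "(\<Sum>\<nu>\<in>insert \<mu> F. w \<nu>) = 0"
    using assms(1,2) u(2) by (simp add: w_def)
  ultimately have "w \<mu> = 0"
    using E_independent[of "insert \<mu> F" w \<mu>] assms(1) by simp
  then show ?thesis by (simp add: w_def)
qed

text \<open>Let S be the sum of all \<open>E \<nu>\<close>. Modulo \<open>E \<mu>\<close>, the map
  \<open>f - \<mu>\<close> sends S onto S, so \<open>(f - \<mu>) v\<close> has an approximate
  preimage \<open>u\<close> in S. Then \<open>(f - \<mu>) (u - v)\<close> lies in
  \<open>E \<mu>\<close>, hence so does \<open>u - v\<close>, and \<open>v\<close> is in S.\<close>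

lemma span_E_if_shifted:
  assumes "shifted \<mu> v \<in> span (\<Union>\<nu>. E \<nu>)"
  shows "v \<in> span (\<Union>\<nu>. E \<nu>)"
proof -
  have "\<exists>u\<in>span (\<Union>\<nu>. E \<nu>). shifted \<mu> u - w \<in> E \<mu>" if "w \<in> span (\<Union>\<nu>. E \<nu>)" for w
    using that
  proof (induction rule: span_induct_alt)
    case base
    then show ?case
      by (intro bexI[of _ 0]) (auto simp: shifted_zero span_zero subspace_0[OF subspace_E])
  next
    case (step c x y)
    then obtain u where u: "u \<in> span (\<Union>\<nu>. E \<nu>)" "shifted \<mu> u - y \<in> E \<mu>" by blast
    obtain \<nu> where \<nu>: "x \<in> E \<nu>" using step by blast
    have "\<exists>x'\<in>span (\<Union>\<nu>. E \<nu>). shifted \<mu> x' - x \<in> E \<mu>"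
    proof (cases "\<nu> = \<mu>")
      case True
      \<comment> \<open>On \<open>E \<mu>\<close> itself the map may fail to be surjective; the
        preimage 0 leaves the error \<open>- x\<close>, which is allowed.\<close>
      then show ?thesis
        using \<nu> by (intro bexI[of _ 0])
          (auto simp: shifted_zero span_zero subspace_E subspace_neg)
    next
      case False
      then obtain x' where "x' \<in> E \<nu>" "shifted \<mu> x' = x"
        using shifted_surj_on_E \<nu> by metis
      then show ?thesis
        by (intro bexI[of _ x']) (auto intro: span_base simp: subspace_0[OF subspace_E])
    qed
    then obtain x' where x': "x' \<in> span (\<Union>\<nu>. E \<nu>)" "shifted \<mu> x' - x \<in> E \<mu>" by blast
    have "shifted \<mu> (c *s x' + u) - (c *s x + y) = c *s (shifted \<mu> x' - x) + (shifted \<mu> u - y)"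
      unfolding shifted_add shifted_scale by (simp add: scale_right_diff_distrib)
    also have "\<dots> \<in> E \<mu>"
      using u x' subspace_E by (metis subspace_add subspace_scale)
    finally show ?case
      using u x' by (metis span_add span_scale)
  qed
  then obtain u where u: "u \<in> span (\<Union>\<nu>. E \<nu>)" "shifted \<mu> u - shifted \<mu> v \<in> E \<mu>"
    using assms by blast
  then have "u - v \<in> E \<mu>"
    using E_if_shifted[of \<mu> "u - v"] by (simp only: shifted_diff)
  then have "u - v \<in> span (\<Union>\<nu>. E \<nu>)"
    by (intro span_base) auto
  from span_diff[OF u(1) this] show ?thesis by simp
qed

section \<open>Polynomials in an endomorphism\<close>

definition poly_act :: "'k poly \<Rightarrow> 'v \<Rightarrow> 'v" where
  "poly_act p v = (\<Sum>i\<le>degree p. coeff p i *s (f ^^ i) v)"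

lemma poly_act_eq:
  "degree p \<le> n \<Longrightarrow> poly_act p v = (\<Sum>i\<le>n. coeff p i *s (f ^^ i) v)"
  unfolding poly_act_def by (rule sum.mono_neutral_left) (auto simp: coeff_eq_0)

lemma poly_act_linear_factor: "poly_act ([:- \<mu>, 1:] * q) v = poly_act q (shifted \<mu> v)"
proof -
  define n where "n = degree q"
  interpret P: endomorphism scale "f ^^ i" for i
    by (rule endomorphism_funpow)
  \<comment> \<open>The product is \<open>X q - \<mu> q\<close>, with \<open>pCons 0 q\<close>
    standing for \<open>X q\<close>; summing up to \<open>Suc n\<close> accommodates both
    terms.\<close>
  have "poly_act ([:- \<mu>, 1:] * q) v =
      (\<Sum>i\<le>Suc n. (coeff (pCons 0 q) i - \<mu> * coeff q i) *s (f ^^ i) v)"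
    using degree_mult_le[of "[:- \<mu>, 1:]" q] by (subst poly_act_eq[of _ "Suc n"]) (simp_all add: n_def)
  also have "\<dots> = (\<Sum>i\<le>Suc n. coeff (pCons 0 q) i *s (f ^^ i) v)
      - (\<Sum>i\<le>Suc n. (\<mu> * coeff q i) *s (f ^^ i) v)"
    by (simp add: scale_left_diff_distrib sum_subtractf del: sum.atMost_Suc)
  also have "(\<Sum>i\<le>Suc n. coeff (pCons 0 q) i *s (f ^^ i) v) = (\<Sum>i\<le>n. coeff q i *s (f ^^ i) (f v))"
    by (subst sum.atMost_Suc_shift) (simp add: funpow_swap1)
  also have "(\<Sum>i\<le>Suc n. (\<mu> * coeff q i) *s (f ^^ i) v) = (\<Sum>i\<le>n. (\<mu> * coeff q i) *s (f ^^ i) v)"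
    by (simp add: n_def coeff_eq_0)
  also have "(\<Sum>i\<le>n. coeff q i *s (f ^^ i) (f v)) - \<dots> = poly_act q (shifted \<mu> v)"
    by (simp add: poly_act_def shifted_def n_def P.map_diff P.map_scale sum_subtractf
        scale_right_diff_distrib mult.commute)
  finally show ?thesis .
qed

end

section \<open>Decomposition over an algebraically closed field\<close>

locale fd_endomorphism = endomorphism scale f
  for scale :: "'k::alg_closed_field \<Rightarrow> 'v::ab_group_add \<Rightarrow> 'v" (infixr \<open>*s\<close> 75) and f +
  assumes finite_dim: "\<exists>B. finite B \<and> span B = UNIV"
begin

text \<open>Split off a root: if \<open>p = (X - \<mu>) q\<close>, then \<open>q(f)\<close> kills
  \<open>(f - \<mu>) v\<close>, which the induction hypothesis puts in the sum of the
  \<open>E \<nu>\<close>, and \<open>span_E_if_shifted\<close> pulls this back to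
  \<open>v\<close>.\<close>

lemma span_E_if_poly_act_eq_0:
  "p \<noteq> 0 \<Longrightarrow> poly_act p v = 0 \<Longrightarrow> v \<in> span (\<Union>\<nu>. E \<nu>)"
proof (induction "degree p" arbitrary: p v)
  case 0
  then have "coeff p 0 *s v = 0" "coeff p 0 \<noteq> 0"
    using leading_coeff_0_iff[of p] by (simp_all add: poly_act_def)
  then show ?case by (simp add: span_zero)
next
  case (Suc n)
  then obtain \<mu> where "poly p \<mu> = 0"
    using alg_closed_imp_poly_has_root[of p] by auto
  then obtain q where q: "p = [:- \<mu>, 1:] * q"
    by (auto simp: poly_eq_0_iff_dvd)
  then have "q \<noteq> 0" using Suc.prems by auto
  then have "degree p = Suc (degree q)"
    unfolding q by (subst degree_mult_eq) auto
  then have "shifted \<mu> v \<in> span (\<Union>\<nu>. E \<nu>)"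
    using Suc.hyps(2) Suc.prems(2) \<open>q \<noteq> 0\<close>
    by (intro Suc.hyps(1)[of q]) (auto simp: q poly_act_linear_factor simp del: mult_pCons_left)
  then show ?case by (rule span_E_if_shifted)
qed

text \<open>The iterates \<open>(f ^^ i) v\<close> are dependent, which yields a nonzero
  annihilating polynomial for each \<open>v\<close>.\<close>

lemma span_E: "span (\<Union>\<nu>. E \<nu>) = UNIV"
proof (intro UNIV_eq_I[symmetric])
  fix v
  obtain B where "finite B" "span B = UNIV" using finite_dim by blast
  then obtain p where "p \<noteq> 0" "(\<Sum>i\<le>degree p. coeff p i *s (f ^^ i) v) = 0"
    using sequence_dependent[of B "\<lambda>i. (f ^^ i) v"] by blast
  then show "v \<in> span (\<Union>\<nu>. E \<nu>)"
    using span_E_if_poly_act_eq_0[of p v] by (simp add: poly_act_def)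
qed

lemma span_E_eigenvalues: "span (\<Union>\<nu>\<in>{\<mu>. is_eigenvalue scale f \<mu>}. E \<nu>) = UNIV"
proof -
  have "(\<Union>\<nu>. E \<nu>) \<subseteq> span (\<Union>\<nu>\<in>{\<mu>. is_eigenvalue scale f \<mu>}. E \<nu>)"
  proof
    fix v assume "v \<in> (\<Union>\<nu>. E \<nu>)"
    then show "v \<in> span (\<Union>\<nu>\<in>{\<mu>. is_eigenvalue scale f \<mu>}. E \<nu>)"
      using eigenvalue_if_E_nontrivial by (cases "v = 0") (auto simp: span_zero intro!: span_base)
  qed
  then show ?thesis
    using span_minimal[OF _ subspace_span] span_E by blast
qed

lemma ex_eigenvalue:
  assumes "(v :: 'v) \<noteq> 0"
  shows "\<exists>\<mu>. is_eigenvalue scale f \<mu>"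
proof (rule ccontr)
  assume "\<nexists>\<mu>. is_eigenvalue scale f \<mu>"
  then have "{\<mu>. is_eigenvalue scale f \<mu>} = {}" by blast
  then have "span {} = (UNIV :: 'v set)"
    using span_E_eigenvalues by (simp only: UN_empty)
  then show False
    using assms unfolding span_empty by blast
qed

text \<open>Each vector of a finite spanning set involves finitely many \<open>E \<nu>\<close>, so a
  finite \<open>F\<close> already gives the whole space. An eigenvector for a value outside
  \<open>F\<close> would then be zero by \<open>E_Int_span\<close>.\<close>

lemma finite_eigenvalues: "finite {\<mu>. is_eigenvalue scale f \<mu>}"
proof -
  have "\<exists>F. finite F \<and> v \<in> span (\<Union>\<nu>\<in>F. E \<nu>)" for v
  proof -
    have "v \<in> span (\<Union>\<nu>. E \<nu>)" by (simp add: span_E)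
    then show ?thesis
    proof (induction rule: span_induct_alt)
      case base
      then show ?case by (intro exI[of _ "{}"]) simp
    next
      case (step c x y)
      then obtain F \<mu> where F: "finite F" "y \<in> span (\<Union>\<nu>\<in>F. E \<nu>)" "x \<in> E \<mu>" by blast
      have "y \<in> span (\<Union>\<nu>\<in>insert \<mu> F. E \<nu>)"
        using F(2) span_mono[of "\<Union>\<nu>\<in>F. E \<nu>" "\<Union>\<nu>\<in>insert \<mu> F. E \<nu>"] by auto
      moreover have "x \<in> span (\<Union>\<nu>\<in>insert \<mu> F. E \<nu>)"
        using F(3) by (intro span_base) auto
      ultimately show ?case
        using F(1) by (intro exI[of _ "insert \<mu> F"]) (simp only: finite_insert span_add span_scale)
    qed
  qed
  then obtain G where G: "\<And>v. finite (G v)" "\<And>v. v \<in> span (\<Union>\<nu>\<in>G v. E \<nu>)" by metis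
  obtain B where B: "finite B" "span B = UNIV" using finite_dim by blast
  define F where "F = (\<Union>b\<in>B. G b)"
  have "B \<subseteq> span (\<Union>\<nu>\<in>F. E \<nu>)"
  proof
    fix b assume "b \<in> B"
    then show "b \<in> span (\<Union>\<nu>\<in>F. E \<nu>)"
      using G(2)[of b] span_mono[of "\<Union>\<nu>\<in>G b. E \<nu>" "\<Union>\<nu>\<in>F. E \<nu>"] by (auto simp: F_def)
  qed
  then have *: "span (\<Union>\<nu>\<in>F. E \<nu>) = UNIV"
    using B(2) span_minimal[OF _ subspace_span] by blast
  have "finite F" using B(1) G(1) by (simp add: F_def)
  moreover have "{\<mu>. is_eigenvalue scale f \<mu>} \<subseteq> F"
  proof
    fix \<mu> assume "\<mu> \<in> {\<mu>. is_eigenvalue scale f \<mu>}"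
    then obtain v where v: "v \<noteq> 0" "v \<in> E \<mu>"
      using eigenvector_in_E by (auto simp: is_eigenvalue_def)
    then show "\<mu> \<in> F"
      using E_Int_span[OF \<open>finite F\<close> _ v(2)] * by auto
  qed
  ultimately show ?thesis by (rule finite_subset[rotated])
qed

lemma is_direct_sum_E: "is_direct_sum {\<mu>. is_eigenvalue scale f \<mu>} E"
  unfolding is_direct_sum_def
proof (intro conjI allI)
  let ?I = "{\<mu>. is_eigenvalue scale f \<mu>}"
  show "finite ?I" by (rule finite_eigenvalues)
  fix v
  have "v \<in> span (\<Union>\<nu>\<in>?I. E \<nu>)" using span_E_eigenvalues by simp
  then obtain u where u: "\<And>\<nu>. u \<nu> \<in> E \<nu>" "v = (\<Sum>\<nu>\<in>?I. u \<nu>)"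
    using sum_of_E_if_span finite_eigenvalues by metis
  show "\<exists>!u. u \<in> PiE ?I E \<and> v = (\<Sum>i\<in>?I. u i)"
  \<comment> \<open>Restriction makes the family undefined outside the eigenvalues, as
    \<open>PiE\<close> demands.\<close>
  proof (rule ex1I[of _ "restrict u ?I"])
    show "restrict u ?I \<in> PiE ?I E \<and> v = (\<Sum>i\<in>?I. restrict u ?I i)"
      using u by auto
    fix w assume w: "w \<in> PiE ?I E \<and> v = (\<Sum>i\<in>?I. w i)"
    have "w \<nu> - u \<nu> = 0" if "\<nu> \<in> ?I" for \<nu>
      using that w u finite_eigenvalues subspace_E
      by (intro E_independent[of ?I "\<lambda>\<nu>. w \<nu> - u \<nu>"]) (auto simp: sum_subtractf subspace_diff PiE_mem)
    then show "w = restrict u ?I"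
      using w by (intro PiE_ext[of w ?I E]) (use u in auto)
  qed
qed

end

section \<open>Pairs of endomorphisms with \<open>[T, Z] = Z^2\<close>\<close>

text \<open>Models the actions of \<open>t\<close> and \<open>z\<close>, leaving
  \<open>x\<^sub>1\<close> to enter later as a third map.\<close>

locale fd_twisted_pair = T: fd_endomorphism scale T + Z: endomorphism scale Z
  for scale :: "'k::{alg_closed_field, field_char_0} \<Rightarrow> 'v::ab_group_add \<Rightarrow> 'v" (infixr \<open>*s\<close> 75)
    and T Z +
  assumes T_Z: "T (Z w) = Z (T w) + Z (Z w)"
begin

sublocale Z: fd_endomorphism scale Z
  by unfold_locales (rule T.finite_dim)

text \<open>The commutator with \<open>T\<close> is a derivation, and it sends
  \<open>Z - \<mu>\<close> to \<open>Z^2\<close>, which commutes with \<open>Z - \<mu>\<close>;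
  hence the power rule.\<close>

lemma T_shifted_funpow_Z:
  "T ((Z.shifted \<mu> ^^ Suc j) w) =
    (Z.shifted \<mu> ^^ Suc j) (T w) + of_nat (Suc j) *s (Z.shifted \<mu> ^^ j) (Z (Z w))"
proof (induction j)
  case 0
  show ?case by (simp add: Z.shifted_def T.map_diff T.map_scale T_Z)
next
  case (Suc j)
  have *: "T (Z.shifted \<mu> u) = Z.shifted \<mu> (T u) + Z (Z u)" for u
    by (simp add: Z.shifted_def T.map_diff T.map_scale T_Z)
  let ?u = "(Z.shifted \<mu> ^^ Suc j) w"
  have "T ((Z.shifted \<mu> ^^ Suc (Suc j)) w) = Z.shifted \<mu> (T ?u) + Z (Z ?u)"
    using *[of ?u] by simp
  also have "\<dots> = (Z.shifted \<mu> ^^ Suc (Suc j)) (T w)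
      + of_nat (Suc j) *s (Z.shifted \<mu> ^^ Suc j) (Z (Z w)) + (Z.shifted \<mu> ^^ Suc j) (Z (Z w))"
    unfolding Suc Z.shifted_add Z.shifted_scale Z.shifted_funpow_map by (simp add: Z.shifted_map)
  also have "\<dots> = (Z.shifted \<mu> ^^ Suc (Suc j)) (T w)
      + of_nat (Suc (Suc j)) *s (Z.shifted \<mu> ^^ Suc j) (Z (Z w))"
    unfolding of_nat_Suc[of "Suc j"] T.scale_left_distrib
    by (simp add: add_ac del: of_nat_Suc funpow.simps)
  finally show ?case .
qed

text \<open>Passing from \<open>k\<close> to \<open>k + 1\<close> multiplies the constant by
  \<open>- (k + 1) \<mu>^2\<close>, nonzero in characteristic 0. Only the nonvanishing is
  recorded.\<close>

lemma shifted_funpow_T_funpow: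
  assumes "Z v = \<mu> *s v" "\<mu> \<noteq> 0"
  shows "\<exists>c. c \<noteq> 0 \<and> (Z.shifted \<mu> ^^ k) ((T ^^ k) v) = c *s v"
proof (induction k)
  case 0
  show ?case by (intro exI[of _ 1]) simp
next
  case (Suc k)
  then obtain c where c: "c \<noteq> 0" "(Z.shifted \<mu> ^^ k) ((T ^^ k) v) = c *s v" by blast
  have "Z.shifted \<mu> (c *s v) = 0"
    using assms(1) by (simp add: Z.shifted_def Z.map_scale mult.commute)
  \<comment> \<open>One factor \<open>Z - \<mu>\<close> beyond the \<open>k\<close>-th kills the
    multiple of \<open>v\<close>, so only the commutator term survives below.\<close>
  then have "(Z.shifted \<mu> ^^ Suc k) ((T ^^ k) v) = 0"
    by (simp add: c)
  then have "(Z.shifted \<mu> ^^ Suc k) (T ((T ^^ k) v)) =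
      - (of_nat (Suc k) *s (Z.shifted \<mu> ^^ k) (Z (Z ((T ^^ k) v))))"
    using T_shifted_funpow_Z[where \<mu> = \<mu> and j = k and w = "(T ^^ k) v"]
    by (simp add: T.map_zero eq_neg_iff_add_eq_0 del: of_nat_Suc funpow.simps)
  also have "\<dots> = (- (of_nat (Suc k) * (c * (\<mu> * \<mu>)))) *s v"
    unfolding Z.shifted_funpow_map c
    by (simp add: Z.map_scale assms(1) mult.assoc del: of_nat_Suc)
  finally show ?case
    using c(1) assms(2)
    by (intro exI[of _ "- (of_nat (Suc k) * (c * (\<mu> * \<mu>)))"]) (simp del: of_nat_Suc)
qed

text \<open>Apply \<open>(Z - \<mu>)^d\<close> to a relation of degree \<open>d\<close> among the
  \<open>T^i v\<close>: the terms with \<open>i < d\<close> vanish, and the leading one is a nonzero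
  multiple of \<open>v\<close>.\<close>

lemma Z_eigenvalue_eq_0:
  assumes "is_eigenvalue scale Z \<mu>"
  shows "\<mu> = 0"
proof (rule ccontr)
  assume "\<mu> \<noteq> 0"
  from assms obtain v where v: "v \<noteq> 0" "Z v = \<mu> *s v"
    by (auto simp: is_eigenvalue_def)
  obtain B where B: "finite B" "T.span B = UNIV" using T.finite_dim by blast
  obtain p where p: "p \<noteq> 0" "(\<Sum>i\<le>degree p. coeff p i *s (T ^^ i) v) = 0"
    by (rule T.sequence_dependent[OF B, of "\<lambda>i. (T ^^ i) v"])
  define d where "d = degree p"
  interpret N: endomorphism scale "Z.shifted \<mu> ^^ d"
    by (rule Z.endomorphism_shifted_funpow)
  have low: "(Z.shifted \<mu> ^^ d) ((T ^^ i) v) = 0" if i: "i < d" for i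
  proof -
    obtain c where "(Z.shifted \<mu> ^^ i) ((T ^^ i) v) = c *s v"
      using shifted_funpow_T_funpow[OF v(2) \<open>\<mu> \<noteq> 0\<close>] by blast
    then have "(Z.shifted \<mu> ^^ Suc i) ((T ^^ i) v) = 0"
      using v(2) by (simp add: Z.shifted_def Z.map_scale mult.commute)
    then show ?thesis
      by (rule Z.shifted_funpow_eq_0_mono) (use i in simp)
  qed
  obtain c where c: "c \<noteq> 0" "(Z.shifted \<mu> ^^ d) ((T ^^ d) v) = c *s v"
    using shifted_funpow_T_funpow[OF v(2) \<open>\<mu> \<noteq> 0\<close>] by blast
  have "0 = (Z.shifted \<mu> ^^ d) (\<Sum>i\<le>d. coeff p i *s (T ^^ i) v)"
    using p(2) by (simp add: d_def N.map_zero[unfolded d_def])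
  also have "\<dots> = (\<Sum>i\<le>d. coeff p i *s (Z.shifted \<mu> ^^ d) ((T ^^ i) v))"
    by (simp only: N.map_sum N.map_scale)
  also have "\<dots> = (\<Sum>i\<in>{d}. coeff p i *s (Z.shifted \<mu> ^^ d) ((T ^^ i) v))"
    by (rule sum.mono_neutral_right) (auto simp: low)
  also have "\<dots> = (lead_coeff p * c) *s v"
    by (simp add: c(2) flip: d_def)
  finally show False
    using p(1) c(1) v(1) by simp
qed

text \<open>With 0 as the only possible eigenvalue, the decomposition for \<open>Z\<close> reduces
  to \<open>Z.E 0\<close>.\<close>

lemma Z_locally_nilpotent: "\<exists>n. (Z ^^ n) v = 0"
proof -
  have "w \<in> Z.E 0" if "w \<in> Z.E \<mu>" for w \<mu>
    using that Z.eigenvalue_if_E_nontrivial[OF that] Z_eigenvalue_eq_0[of \<mu>]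
      T.subspace_0[OF Z.subspace_E]
    by (cases "w = 0") simp_all
  then have "(\<Union>\<mu>. Z.E \<mu>) \<subseteq> Z.E 0"
    by blast
  then have "v \<in> Z.E 0"
    using T.span_minimal[OF _ Z.subspace_E] Z.span_E by blast
  then show ?thesis
    by (simp add: Z.mem_E_iff Z.shifted_0)
qed

text \<open>If \<open>[T, A] = A Z\<close>, then moving \<open>m\<close> factors \<open>T - \<mu>\<close> past \<open>A\<close> leaves a combination of
  the vectors \<open>A (Z ^^ j) ((T - \<mu>) ^^ k) v\<close> with \<open>j + k = m\<close>; these all vanish for large \<open>m\<close>.\<close>

lemma E_twisted:
  assumes "endomorphism scale A" and T_A: "\<And>w. T (A w) = A (T w) + A (Z w)"
    and v: "v \<in> T.E \<mu>"
  shows "A v \<in> T.E \<mu>"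
proof -
  interpret A: endomorphism scale A by fact
  let ?D = "T.shifted \<mu>"
  define g where "g j k = A ((Z ^^ j) ((?D ^^ k) v))" for j k
  define R where "R m = T.span {g j k |j k. j + k = m}" for m
  have D_A: "?D (A w) = A (?D w) + A (Z w)" for w
    by (simp add: T.shifted_def T_A A.map_diff A.map_scale)
  have D_Z: "?D ((Z ^^ j) w) = (Z ^^ j) (?D w) + of_nat j *s (Z ^^ Suc j) w" for j w
  proof (induction j)
    case (Suc j)
    have "?D (Z u) = Z (?D u) + Z (Z u)" for u
      by (simp add: T.shifted_def T_Z Z.map_diff Z.map_scale)
    then have "?D ((Z ^^ Suc j) w) = Z (?D ((Z ^^ j) w)) + Z (Z ((Z ^^ j) w))"
      by simp
    then show ?case
      unfolding Suc by (simp add: Z.map_add Z.map_scale T.scale_left_distrib add_ac)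
  qed simp
  \<comment> \<open>The coefficient collects \<open>j\<close> from passing \<open>Z^j\<close> and 1
    from passing \<open>A\<close>.\<close>
  have D_g: "?D (g j k) = g j (Suc k) + of_nat (Suc j) *s g (Suc j) k" for j k
    by (simp add: g_def D_A D_Z A.map_add A.map_scale T.scale_left_distrib add_ac)
  have "?D u \<in> R (Suc m)" if "u \<in> R m" for u m
    using that unfolding R_def
  proof (induction rule: T.span_induct_alt)
    case base
    show ?case by (simp add: T.shifted_zero T.span_zero)
  next
    case (step c x y)
    then obtain j k where x: "x = g j k" "j + k = m" by blast
    have "g j' k' \<in> R (Suc m)" if "j' + k' = Suc m" for j' k'
      using that unfolding R_def by (intro T.span_base) blast
    then have "g j (Suc k) \<in> R (Suc m)" "g (Suc j) k \<in> R (Suc m)"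
      using x(2) by simp_all
    then have "?D x \<in> R (Suc m)"
      unfolding x(1) D_g unfolding R_def by (intro T.span_add T.span_scale)
    then show ?case
      using step.IH unfolding R_def T.shifted_add T.shifted_scale
      by (intro T.span_add T.span_scale)
  qed
  then have DA: "(?D ^^ m) (A v) \<in> R m" for m
  proof (induction m)
    case 0
    have "A v = g 0 0" by (simp add: g_def)
    then show ?case unfolding R_def by (auto intro: T.span_base)
  qed simp
  obtain n where n: "(?D ^^ n) v = 0"
    using v by (auto simp: T.mem_E_iff)
  obtain h where h: "\<And>w. (Z ^^ h w) w = 0"
    using Z_locally_nilpotent by metis
  \<comment> \<open>The sum bounds the nilpotency exponents of the finitely many nonzero
    \<open>(T - \<mu>)^k v\<close>. If \<open>j + k = n + N\<close>, then either
    \<open>k \<ge> n\<close>, or \<open>j > N\<close> and \<open>Z^j\<close> kills that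
    vector.\<close>
  define N where "N = (\<Sum>k<n. h ((?D ^^ k) v))"
  have g0: "g j k = 0" if "j + k = n + N" for j k
  proof (cases "k < n")
    case True
    have "h ((?D ^^ k) v) \<le> N"
      unfolding N_def using True by (intro member_le_sum) auto
    then have "(Z ^^ j) ((?D ^^ k) v) = 0"
      using Z.shifted_funpow_eq_0_mono[of "h ((?D ^^ k) v)" 0 "(?D ^^ k) v" j] h that True
      by (simp add: Z.shifted_0)
    then show ?thesis by (simp add: g_def A.map_zero)
  next
    case False
    then have "(?D ^^ k) v = 0"
      using T.shifted_funpow_eq_0_mono[OF n] by simp
    then have "g j k = A ((Z.shifted 0 ^^ j) 0)"
      by (simp add: g_def Z.shifted_0)
    then show ?thesis by (simp add: Z.shifted_funpow_zero A.map_zero)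
  qed
  then have "{g j k |j k. j + k = n + N} \<subseteq> {0}" by auto
  then have "R (n + N) \<subseteq> {0}"
    unfolding R_def using T.span_minimal[OF _ T.subspace_single_0] by blast
  then have "(?D ^^ (n + N)) (A v) = 0"
    using DA by blast
  then show ?thesis
    unfolding T.mem_E_iff by blast
qed

end

section \<open>The super Jordan plane and its representations\<close>

text \<open>Rewriting with \<open>y x = z - x y\<close> and \<open>y z = z y + x z\<close> moves
  each \<open>y\<close> to the right; in the second identity the leftover \<open>x x z\<close>
  vanishes.\<close>

lemma square_commutators:
  fixes x y :: "'a::ring_1"
  defines "z \<equiv> x * y + y * x"
  assumes xx: "x * x = 0" and yz: "y * z = z * y + x * z"
  shows "y * y * x = x * (y * y) + x * z" "y * y * z = z * (y * y) + z * z"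
proof -
  have yx: "y * x = z - x * y" by (simp add: z_def)
  have "y * y * x = y * z - y * x * y"
    by (simp add: z_def algebra_simps)
  also have "\<dots> = z * y + x * z - (z - x * y) * y"
    by (simp only: yz yx)
  finally show "y * y * x = x * (y * y) + x * z"
    by (simp add: algebra_simps)
  have "y * y * z = y * (z * y + x * z)"
    by (simp only: mult.assoc yz)
  also have "\<dots> = (y * z) * y + (y * x) * z"
    by (simp add: algebra_simps)
  also have "\<dots> = (z * y + x * z) * y + z * z - x * (z * y + x * z)"
    unfolding yz[symmetric] yx by (simp add: algebra_simps)
  also have "\<dots> = z * (y * y) + z * z - x * x * z"
    by (simp add: algebra_simps)
  finally show "y * y * z = z * (y * y) + z * z"
    by (simp add: xx)
qed

context sjp_fd_representation
begin

lemma rep_zero: "\<rho> 0 v = 0"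
  using rep_add[of 0 0 v] by simp

lemma endomorphism_rep: "endomorphism scale (\<rho> a)"
  by (simp add: endomorphism_def endomorphism_axioms_def vector_space_axioms linear_rep)

text \<open>Stability under the generators passes to words by induction on letters, to the free
  algebra by adding monomials, and to the quotient through representatives.\<close>

lemma is_submoduleI:
  assumes U: "subspace U"
    and x1: "\<And>u. u \<in> U \<Longrightarrow> \<rho> sjp_x1 u \<in> U" and x2: "\<And>u. u \<in> U \<Longrightarrow> \<rho> sjp_x2 u \<in> U"
  shows "is_submodule scale \<rho> U"
proof -
  have word: "\<rho> (abs_sjp (Poly_Mapping.single (Word ls) 1)) u \<in> U" if "u \<in> U" for ls u
  proof (induction ls)
    case Nil
    have "abs_sjp (Poly_Mapping.single (Word []) 1) = (1 :: 'k sjp)"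
      by (simp add: one_sjp.abs_eq flip: zero_word_def)
    then show ?case using that by (simp add: rep_one)
  next
    case (Cons l ls)
    have "abs_sjp (Poly_Mapping.single (Word (l # ls)) 1) =
        abs_sjp (Poly_Mapping.single (Word [l]) 1) *
        (abs_sjp (Poly_Mapping.single (Word ls) 1) :: 'k sjp)"
      by (simp add: times_sjp.abs_eq mult_single plus_word_def)
    moreover have "abs_sjp (Poly_Mapping.single (Word [l]) 1) \<in> {sjp_x1, sjp_x2 :: 'k sjp}"
      by (cases l) (simp_all add: sjp_x1.abs_eq sjp_x2.abs_eq fx1_def fx2_def)
    ultimately show ?case
      using Cons x1 x2 by (auto simp: rep_mult)
  qed
  have "\<rho> (abs_sjp g) u \<in> U" if "u \<in> U" for g u
  proof (induction g rule: update_induct)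
    case const
    then show ?case
      using rep_zero[of u] subspace_0[OF U] by (simp add: zero_sjp.abs_eq)
  next
    case (update g w c)
    \<comment> \<open>The word \<open>w\<close> is not yet a key of \<open>g\<close>, so updating
      there is adding a monomial.\<close>
    have "Poly_Mapping.update w c g = Poly_Mapping.single w c + g"
      using update.hyps
      by (intro poly_mapping_eqI) (auto simp: lookup_update lookup_add lookup_single in_keys_iff when_def)
    also have "Poly_Mapping.single w c = fscalar c * Poly_Mapping.single (Word (letters w)) 1"
      by (simp add: fscalar_def mult_single)
    finally have "abs_sjp (Poly_Mapping.update w c g) =
        sjp_scale c (abs_sjp (Poly_Mapping.single (Word (letters w)) 1)) + abs_sjp g"
      by (simp add: plus_sjp.abs_eq sjp_scale.abs_eq)
    then show ?case
      using update.IH word[OF that] U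
      by (simp add: rep_add rep_scale subspace_add subspace_scale del: word.collapse)
  qed
  then have "\<rho> a u \<in> U" if "u \<in> U" for a u
    using that by (induction a rule: sjp.abs_induct) auto
  then show ?thesis
    using U by (simp add: is_submodule_def)
qed

text \<open>Supplies the complementary submodule when one generalized eigenspace is split
  off.\<close>

lemma is_submodule_span_Union:
  assumes "\<And>i. i \<in> I \<Longrightarrow> is_submodule scale \<rho> (U i)"
  shows "is_submodule scale \<rho> (span (\<Union>i\<in>I. U i))"
proof -
  have "\<rho> a v \<in> span (\<Union>i\<in>I. U i)" if "v \<in> span (\<Union>i\<in>I. U i)" for a v
    using that
  proof (induction rule: span_induct_alt)
    interpret a: endomorphism scale "\<rho> a" by (rule endomorphism_rep)
    case base
    show ?case by (simp add: a.map_zero span_zero)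
  next
    interpret a: endomorphism scale "\<rho> a" by (rule endomorphism_rep)
    case (step c x y)
    then have "\<rho> a x \<in> span (\<Union>i\<in>I. U i)"
      using assms by (intro span_base) (auto simp: is_submodule_def)
    then show ?case
      using step.IH by (simp add: a.map_add a.map_scale span_add span_scale)
  qed
  then show ?thesis by (simp add: is_submodule_def)
qed

end

lemma fd_endomorphism_rep:
  fixes scale :: "'k::alg_closed_field \<Rightarrow> 'v::ab_group_add \<Rightarrow> 'v"
  assumes "sjp_fd_representation scale \<rho>"
  shows "fd_endomorphism scale (\<rho> a)"
proof -
  interpret sjp_fd_representation scale \<rho> by fact
  show ?thesis
    by (simp add: fd_endomorphism_def fd_endomorphism_axioms_def endomorphism_rep finite_dim)
qed

text \<open>The generators suffice: \<open>E_twisted\<close> with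
  \<open>[t, x\<^sub>1] = x\<^sub>1 z\<close> handles \<open>x\<^sub>1\<close>, and
  \<open>x\<^sub>2\<close> commutes with its square.\<close>

lemma E_square_submodule:
  fixes scale :: "'k::{alg_closed_field, field_char_0} \<Rightarrow> 'v::ab_group_add \<Rightarrow> 'v"
  assumes "sjp_fd_representation scale \<rho>"
  shows "is_submodule scale \<rho> (gen_eigenspace scale (\<rho> (sjp_x2 ^ 2)) \<mu>)"
proof -
  interpret sjp_fd_representation scale \<rho> by fact
  define z :: "'k sjp" where "z = sjp_x1 * sjp_x2 + sjp_x2 * sjp_x1"
  interpret T: fd_endomorphism scale "\<rho> (sjp_x2 ^ 2)"
    by (rule fd_endomorphism_rep) fact
  note comm = square_commutators[of "sjp_x1 :: 'k sjp" sjp_x2, folded z_def,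
      OF sjp_x1_squared[unfolded power2_eq_square] sjp_x2_x21[where 'k = 'k, folded z_def]]
  note comm = comm[folded power2_eq_square[of sjp_x2]]
  have rep: "\<rho> a (\<rho> b v) = \<rho> (a * b) v" for a b v
    by (simp add: rep_mult)
  interpret Z: fd_twisted_pair scale "\<rho> (sjp_x2 ^ 2)" "\<rho> z"
    by (simp add: fd_twisted_pair_def fd_twisted_pair_axioms_def T.fd_endomorphism_axioms
        endomorphism_rep rep comm(2) flip: rep_add)
  show ?thesis
  proof (rule is_submoduleI)
    fix u assume u: "u \<in> gen_eigenspace scale (\<rho> (sjp_x2 ^ 2)) \<mu>"
    show "\<rho> sjp_x1 u \<in> gen_eigenspace scale (\<rho> (sjp_x2 ^ 2)) \<mu>"
      by (rule Z.E_twisted[OF endomorphism_rep _ u]) (simp add: rep comm(1) flip: rep_add)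
    show "\<rho> sjp_x2 u \<in> gen_eigenspace scale (\<rho> (sjp_x2 ^ 2)) \<mu>"
      by (rule T.E_commuting[OF endomorphism_rep _ u]) (simp add: rep power2_eq_square mult.assoc)
  qed (rule T.subspace_E)
qed

text \<open>For an eigenvalue \<mu>, the space splits into the nonzero submodule
  \<open>E \<mu>\<close> and the sum \<open>W\<close> of the other generalized eigenspaces.
  Indecomposability forces \<open>W = {0}\<close>, which excludes a second eigenvalue.\<close>

lemma indecomposable_square_eigenvalue:
  fixes scale :: "'k::{alg_closed_field, field_char_0} \<Rightarrow> 'v::ab_group_add \<Rightarrow> 'v"
  assumes "sjp_fd_representation scale \<rho>" and ind: "indecomposable scale \<rho>"
  shows "\<exists>!\<mu>. is_eigenvalue scale (\<rho> (sjp_x2 ^ 2)) \<mu>"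
proof -
  interpret sjp_fd_representation scale \<rho> by fact
  interpret T: fd_endomorphism scale "\<rho> (sjp_x2 ^ 2)"
    by (rule fd_endomorphism_rep) fact
  let ?I = "{\<mu>. is_eigenvalue scale (\<rho> (sjp_x2 ^ 2)) \<mu>}"
  obtain v :: 'v where "v \<noteq> 0"
    using ind by (auto simp: indecomposable_def)
  then obtain \<mu> where \<mu>: "\<mu> \<in> ?I"
    using T.ex_eigenvalue by blast
  have nontrivial: "T.E \<nu> \<noteq> {0}" if "\<nu> \<in> ?I" for \<nu>
    using that T.eigenvector_in_E[of _ \<nu>] by (auto simp: is_eigenvalue_def)
  define W where "W = span (\<Union>\<nu>\<in>?I - {\<mu>}. T.E \<nu>)"
  have "(\<Union>\<nu>\<in>?I. T.E \<nu>) = T.E \<mu> \<union> (\<Union>\<nu>\<in>?I - {\<mu>}. T.E \<nu>)"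
    using \<mu> by auto
  then have "span (T.E \<mu> \<union> (\<Union>\<nu>\<in>?I - {\<mu>}. T.E \<nu>)) = UNIV"
    using T.span_E_eigenvalues by simp
  then have "{u + w |u w. u \<in> T.E \<mu> \<and> w \<in> W} = UNIV"
    unfolding span_Un W_def span_eq_iff[THEN iffD2, OF T.subspace_E] .
  moreover have "T.E \<mu> \<inter> W = {0}"
    using T.E_Int_span[of "?I - {\<mu>}" \<mu>] T.finite_eigenvalues subspace_0[OF T.subspace_E]
    by (auto simp: W_def span_zero)
  moreover have "is_submodule scale \<rho> (T.E \<mu>)" "is_submodule scale \<rho> W"
    unfolding W_def by (intro is_submodule_span_Union E_square_submodule assms)+
  ultimately have "W = {0}"
    using ind nontrivial[OF \<mu>] unfolding indecomposable_def by blast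
  have "\<nu> = \<mu>" if "\<nu> \<in> ?I" for \<nu>
  proof (rule ccontr)
    assume "\<nu> \<noteq> \<mu>"
    then have "T.E \<nu> \<subseteq> W"
      using that unfolding W_def by (auto intro: span_base)
    then show False
      using \<open>W = {0}\<close> nontrivial[OF that] subspace_0[OF T.subspace_E] by auto
  qed
  then show ?thesis using \<mu> by blast
qed

theorem theorem2p11:
  fixes scale :: "'k::{alg_closed_field, field_char_0} \<Rightarrow> 'v::ab_group_add \<Rightarrow> 'v"
    and \<rho> :: "'k sjp \<Rightarrow> 'v \<Rightarrow> 'v"
    and X2 T :: "'v \<Rightarrow> 'v"
  assumes "sjp_fd_representation scale \<rho>"
    and "X2 = \<rho> sjp_x2"
    and "T = \<rho> (sjp_x2 ^ 2)"
  shows "(\<forall>\<mu>. is_eigenvalue scale T \<mu> \<longrightarrow> is_submodule scale \<rho> (gen_eigenspace scale T \<mu>)) \<and>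
    is_direct_sum {\<mu>. is_eigenvalue scale T \<mu>} (gen_eigenspace scale T) \<and>
    (indecomposable scale \<rho> \<longrightarrow>
      (\<exists>!\<mu>. is_eigenvalue scale T \<mu>) \<and>
      ((\<exists>!\<mu>. is_eigenvalue scale X2 \<mu>) \<or>
       (\<exists>l. l \<noteq> 0 \<and> {\<mu>. is_eigenvalue scale X2 \<mu>} = {l, - l})))"
proof -
  interpret sjp_fd_representation scale \<rho> by fact
  interpret T: fd_endomorphism scale T
    unfolding assms(3) by (rule fd_endomorphism_rep) fact
  interpret X2: fd_endomorphism scale X2
    unfolding assms(2) by (rule fd_endomorphism_rep) fact
  have "(\<exists>!\<mu>. is_eigenvalue scale X2 \<mu>) \<or>
      (\<exists>l. l \<noteq> 0 \<and> {\<mu>. is_eigenvalue scale X2 \<mu>} = {l, - l})"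
    if ind: "indecomposable scale \<rho>"
  proof -
    obtain v :: 'v where "v \<noteq> 0"
      using ind by (auto simp: indecomposable_def)
    then obtain l where l: "is_eigenvalue scale X2 l"
      using X2.ex_eigenvalue by blast
    have square: "is_eigenvalue scale T (\<kappa>\<^sup>2)" if "is_eigenvalue scale X2 \<kappa>" for \<kappa>
    proof -
      have "T w = X2 (X2 w)" for w
        by (simp add: assms(2,3) power2_eq_square rep_mult)
      then show ?thesis
        using that by (auto simp: is_eigenvalue_def X2.map_scale power2_eq_square)
    qed
    \<comment> \<open>Both squares equal the unique eigenvalue of \<open>T\<close>.\<close>
    have "\<kappa> = l \<or> \<kappa> = - l" if "is_eigenvalue scale X2 \<kappa>" for \<kappa>
      using indecomposable_square_eigenvalue[OF assms(1) ind, folded assms(3)]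
        square[OF that] square[OF l] power2_eq_iff[of \<kappa> l] by blast
    \<comment> \<open>If \<open>l = 0\<close> or \<open>- l\<close> is not an eigenvalue, then
      \<open>l\<close> is the only one; otherwise the two values form the pair.\<close>
    then show ?thesis
      using l by (cases "l \<noteq> 0 \<and> is_eigenvalue scale X2 (- l)") (blast, metis minus_zero)
  qed
  then show ?thesis
    using E_square_submodule[OF assms(1)] T.is_direct_sum_E
      indecomposable_square_eigenvalue[OF assms(1)]
    unfolding assms(3) by blast
qed

end
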